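(* Let $\Omega$ be a finite nonempty set. A function $\mathrm{Bel}: 2^{\Omega} \to [0,1]$ is a belief function if and only if there exists a coherent and B-consistent betting function $R$ on $\Omega$ such that $\mathrm{Bel}(A) = \mathrm{Buy}_R(1_A)$ for all $A \subseteq \Omega$.
   Context: Throughout, $\Omega$ is a finite nonempty set, and $1_A$ denotes the indicator function of $A \subseteq \Omega$. Belief function: a function $\mathrm{Bel}: 2^{\Omega} \to [0,1]$ such that (B1) $\mathrm{Bel}(\emptyset)=0$ and $\mathrm{Bel}(\Omega)=1$; (B2) for all $N \ge 1$ and all $A_1,\ldots,A_N \subseteq \Omega$, $$\mathrm{Bel}\left(\bigcup_{i=1}^N A_i\right) \geq \sum_{\emptyset \neq I \subseteq \{1,\ldots,N\}} (-1)^{|I|+1}\, \mathrm{Bel}\left(\bigcap_{i \in I} A_i\right).$$ Bets: a bet on $\Omega$ is a function $X: \Omega \to \mathbb{R}$; $\mathcal{X} = \mathbb{R}^{\Omega}$ is the set of all bets. Real numbers are identified with constant bets. Betting function: a function $R: \mathcal{X} \to \{0,1\}$ such that for each $X \in \mathcal{X}$ there is an $\alpha_0 \in \mathbb{R}$ with $R(X+\alpha)=0$ for $\alpha < \alpha_0$ and $R(X+\alpha)=1$ for $\alpha \geq \alpha_0$. Buy function: $\mathrm{Buy}_R(X) := \max\{\alpha \in \mathbb{R} : R(X-\alpha)=1\}$ for $X \in \mathcal{X}$. Coherent: a betting function $R$ is coherent if (R1) $R(X)=1$ whenever $X>0$ (i.e. $X(\omega)>0$ for all $\omega \in \Omega$);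 (R2) $R(\lambda X)=R(X)$ for every $X \in \mathcal{X}$ and $\lambda > 0$; (R3) if $R(X)=R(Y)=1$, then $R(X+Y)=1$. Belief valuation: a function $\mathcal{B}: 2^{\Omega} \to \{0,1\}$ such that: $\mathcal{B}(A^c)=0$ if $\mathcal{B}(A)=1$; if $\mathcal{B}(A)=1$ and $A \subseteq B$, then $\mathcal{B}(B)=1$; if $\mathcal{B}(A)=\mathcal{B}(B)=1$, then $\mathcal{B}(A\cap B)=1$; and $\mathcal{B}(\Omega)=1$. Guaranteed revenue: for a belief valuation $\mathcal{B}$ and $X \in \mathcal{X}$, $G_{\mathcal{B}}(X) := \max_{A : \mathcal{B}(A)=1} \min_{\omega \in A} X(\omega)$. B-consistent: a betting function $R$ is B-consistent if for all finite collections $X_1,\ldots,X_N \in \mathcal{X}$ and $Y_1,\ldots,Y_M \in \mathcal{X}$ ($N, M \ge 1$) such that $\sum_{i=1}^N G_{\mathcal{B}}(X_i) \leq \sum_{j=1}^M G_{\mathcal{B}}(Y_j)$ for every belief valuation $\mathcal{B}$, we have $\sum_{i=1}^N \mathrm{Buy}_R(X_i) \leq \sum_{j=1}^M \mathrm{Buy}_R(Y_j)$. *)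

theory Defs
  imports Complex_Main "HOL-Library.Indicator_Function"
begin

text \<open>
  The finite nonempty set \<open>\<Omega>\<close> is the universe of a type \<open>'a::finite\<close>; bets are functions
  \<open>'a \<Rightarrow> real\<close>. Functions into \<open>{0,1}\<close> (betting functions, belief valuations) are
  predicates, the value 1 being True.
\<close>

definition belief_function :: "('a::finite set \<Rightarrow> real) \<Rightarrow> bool" where
  "belief_function Bel \<longleftrightarrow>
     (\<forall>A. 0 \<le> Bel A \<and> Bel A \<le> 1) \<and>
     Bel {} = 0 \<and> Bel UNIV = 1 \<and>
     (\<forall>N\<ge>1. \<forall>A :: nat \<Rightarrow> 'a set.
        Bel (\<Union>i\<in>{1..N}. A i) \<ge>
          (\<Sum>I | I \<noteq> {} \<and> I \<subseteq> {1..N}. (-1) ^ (card I + 1) * Bel (\<Inter>i\<in>I. A i)))"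

definition betting_function :: "(('a::finite \<Rightarrow> real) \<Rightarrow> bool) \<Rightarrow> bool" where
  "betting_function R \<longleftrightarrow>
     (\<forall>X. \<exists>\<alpha>0. (\<forall>\<alpha><\<alpha>0. \<not> R (\<lambda>\<omega>. X \<omega> + \<alpha>)) \<and> (\<forall>\<alpha>\<ge>\<alpha>0. R (\<lambda>\<omega>. X \<omega> + \<alpha>)))"

definition Buy :: "(('a::finite \<Rightarrow> real) \<Rightarrow> bool) \<Rightarrow> ('a \<Rightarrow> real) \<Rightarrow> real" where
  "Buy R X = (GREATEST \<alpha>. R (\<lambda>\<omega>. X \<omega> - \<alpha>))"

definition coherent :: "(('a::finite \<Rightarrow> real) \<Rightarrow> bool) \<Rightarrow> bool" where
  "coherent R \<longleftrightarrow>
     (\<forall>X. (\<forall>\<omega>. X \<omega> > 0) \<longrightarrow> R X) \<and>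
     (\<forall>X. \<forall>c>0. R (\<lambda>\<omega>. c * X \<omega>) = R X) \<and>
     (\<forall>X Y. R X \<and> R Y \<longrightarrow> R (\<lambda>\<omega>. X \<omega> + Y \<omega>))"

definition belief_valuation :: "('a::finite set \<Rightarrow> bool) \<Rightarrow> bool" where
  "belief_valuation B \<longleftrightarrow>
     (\<forall>A. B A \<longrightarrow> \<not> B (- A)) \<and>
     (\<forall>A C. B A \<and> A \<subseteq> C \<longrightarrow> B C) \<and>
     (\<forall>A C. B A \<and> B C \<longrightarrow> B (A \<inter> C)) \<and>
     B UNIV"

text \<open>
  For a belief valuation \<open>B\<close>, the maximum and the minima below range over nonempty finite sets,
  since \<open>B UNIV\<close> holds and \<open>B {}\<close> fails.
\<close>

definition guaranteed_revenue :: "('a::finite set \<Rightarrow> bool) \<Rightarrow> ('a \<Rightarrow> real) \<Rightarrow> real" where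
  "guaranteed_revenue B X = (MAX A\<in>{A. B A}. MIN \<omega>\<in>A. X \<omega>)"

definition B_consistent :: "(('a::finite \<Rightarrow> real) \<Rightarrow> bool) \<Rightarrow> bool" where
  "B_consistent R \<longleftrightarrow>
     (\<forall>N\<ge>1. \<forall>M\<ge>1. \<forall>(X :: nat \<Rightarrow> 'a \<Rightarrow> real) (Y :: nat \<Rightarrow> 'a \<Rightarrow> real).
        (\<forall>B. belief_valuation B \<longrightarrow>
           (\<Sum>i=1..N. guaranteed_revenue B (X i)) \<le> (\<Sum>j=1..M. guaranteed_revenue B (Y j))) \<longrightarrow>
        (\<Sum>i=1..N. Buy R (X i)) \<le> (\<Sum>j=1..M. Buy R (Y j)))"

text \<open>The maximum defining the buy function is attained for every betting function.\<close>

lemma betting_function_Buy: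
  assumes "betting_function R"
  shows "R (\<lambda>\<omega>. X \<omega> - \<alpha>) \<longleftrightarrow> \<alpha> \<le> Buy R X"
proof -
  obtain a where a: "\<forall>\<alpha><a. \<not> R (\<lambda>\<omega>. X \<omega> + \<alpha>)" "\<forall>\<alpha>\<ge>a. R (\<lambda>\<omega>. X \<omega> + \<alpha>)"
    using assms unfolding betting_function_def by blast
  have iff: "R (\<lambda>\<omega>. X \<omega> - \<beta>) \<longleftrightarrow> \<beta> \<le> - a" for \<beta>
    using a(1)[rule_format, of "- \<beta>"] a(2)[rule_format, of "- \<beta>"] by fastforce
  have "Buy R X = - a"
    unfolding Buy_def by (rule Greatest_equality) (simp_all only: iff order_refl)
  then show ?thesis by (simp add: iff)
qed

end

theory Submission
  imports Defs
begin

text \<open>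
  A belief valuation on a finite set is the filter \<open>{A. C \<subseteq> A}\<close> generated by a nonempty set \<open>C\<close>, and
  its guaranteed revenue is the minimum over \<open>C\<close>.

  Given a belief function \<open>Bel\<close>, its Moebius inverse \<open>mass Bel\<close> is nonnegative on nonempty
  sets: when \<open>C\<close> has at least two elements, it is the union of the sets \<open>C - {c}\<close> with \<open>c \<in> C\<close>, and the
  inclusion-exclusion inequality for these sets says exactly that \<open>mass Bel C \<ge> 0\<close>; for a
  singleton this is \<open>Bel {} \<le> Bel C\<close> (lemma \<open>mass_nonneg\<close>).  These masses add up to
  \<open>Bel UNIV = 1\<close>.  Hence \<open>choquet (mass Bel) X\<close>, the sum of \<open>mass Bel C * Min (X ` C)\<close> over
  the nonempty \<open>C\<close>, is a mixture of guaranteed revenues.  Accepting \<open>X\<close> iff this number is nonnegative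
  defines a betting function whose buy function is the mixture itself.  It is coherent because each
  minimum is superadditive, positively homogeneous and commutes with constants; it is B-consistent
  because an inequality that holds for every guaranteed revenue survives averaging; and Moebius
  inversion gives the value \<open>Bel A\<close> at the indicator of \<open>A\<close>.

  Conversely, the guaranteed revenue of the indicator of \<open>A\<close> is 1 or 0 according to whether the
  valuation holds at \<open>A\<close>, and with these 0/1 values every valuation satisfies the
  inclusion-exclusion inequality (lemma \<open>valuation_inclusion_exclusion\<close>).  Moving the
  negative terms to the other side turns it into a comparison of two finite sums of guaranteed
  revenues, which B-consistency transfers to the buy function.  Coherence fixes the values at the
  empty and the full set, since it forces the price of a constant bet to be that constant
  (lemma \<open>Buy_const\<close>).
\<close>

section \<open>Inclusion-exclusion inequalities\<close>

text \<open>
  The members of an inclusion-exclusion inequality for \<open>A 1, \<dots>, A N\<close>, indexed by all the subsets of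
  \<open>{1..N}\<close>: the empty index set, which is not otherwise in use, stands for the union.
\<close>

definition incl_excl_set :: "nat \<Rightarrow> (nat \<Rightarrow> 'a set) \<Rightarrow> nat set \<Rightarrow> 'a set" where
  "incl_excl_set N A I = (if I = {} then \<Union>i\<in>{1..N}. A i else \<Inter>i\<in>I. A i)"

text \<open>
  With the union as an extra term, the inequality becomes the nonnegativity of an alternating sum
  over a full power set.
\<close>

lemma inclusion_exclusion_iff:
  fixes f :: "'a set \<Rightarrow> real"
  shows "(\<Sum>I | I \<noteq> {} \<and> I \<subseteq> {1..N}. (-1) ^ (card I + 1) * f (\<Inter>i\<in>I. A i)) \<le> f (\<Union>i\<in>{1..N}. A i)
    \<longleftrightarrow> 0 \<le> (\<Sum>I\<in>Pow {1..N}. (-1) ^ card I * f (incl_excl_set N A I))"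
proof -
  have "Pow {1..N} = insert {} {I. I \<noteq> {} \<and> I \<subseteq> {1..N}}"
    by auto
  moreover have "finite {I. I \<noteq> {} \<and> I \<subseteq> {1..N}}"
    by (rule finite_subset[of _ "Pow {1..N}"]) auto
  ultimately have "(\<Sum>I\<in>Pow {1..N}. (-1) ^ card I * f (incl_excl_set N A I)) =
      f (\<Union>i\<in>{1..N}. A i) + (\<Sum>I | I \<noteq> {} \<and> I \<subseteq> {1..N}. (-1) ^ card I * f (incl_excl_set N A I))"
    by (simp add: incl_excl_set_def)
  also have "(\<Sum>I | I \<noteq> {} \<and> I \<subseteq> {1..N}. (-1) ^ card I * f (incl_excl_set N A I)) =
      - (\<Sum>I | I \<noteq> {} \<and> I \<subseteq> {1..N}. (-1) ^ (card I + 1) * f (\<Inter>i\<in>I. A i))"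
    unfolding sum_negf[symmetric] by (rule sum.cong) (auto simp: incl_excl_set_def)
  finally show ?thesis
    by simp
qed

lemma sum_alternating_Pow:
  assumes "finite S"
  shows "(\<Sum>I\<in>Pow S. (-1) ^ card I) = (if S = {} then 1 else 0 :: 'b::ring_1)"
proof -
  have "(\<Sum>T\<in>Pow S. (-1) ^ card T * (if T = {} then 1 else 0 :: 'b)) = 1"
    if "finite S" for S :: "'a set"
  proof -
    have "(\<Sum>T\<in>Pow S. (-1) ^ card T * (if T = {} then 1 else 0 :: 'b)) =
        (\<Sum>T\<in>Pow S. if T = {} then 1 else 0)"
      by (rule sum.cong) auto
    then show ?thesis
      using that by simp
  qed
  then show ?thesis
    \<comment> \<open>The signed Moebius transform is an involution, and by the above it sends the indicator of
      the empty set to the constant 1.\<close>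
    using inclusion_exclusion_symmetric[of "\<lambda>_. 1" "\<lambda>S. if S = {} then 1 else 0 :: 'b" S] assms
    by simp
qed

lemma sum_alternating_split:
  fixes f :: "'a set \<Rightarrow> real"
  assumes "finite S"
  shows "(\<Sum>I\<in>Pow S. (-1) ^ card I * f I) =
    (\<Sum>I\<in>{I\<in>Pow S. even (card I)}. f I) - (\<Sum>I\<in>{I\<in>Pow S. odd (card I)}. f I)"
proof -
  have "(\<Sum>I\<in>Pow S. (-1) ^ card I * f I) =
      (\<Sum>I\<in>Pow S. (if even (card I) then f I else 0) - (if odd (card I) then f I else 0))"
    by (rule sum.cong) auto
  then show ?thesis
    using assms by (simp add: sum_subtractf sum.inter_filter del: Pow_iff)
qed

section \<open>The mass of a belief function\<close>

text \<open>The Moebius inverse of a set function.\<close>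

definition mass :: "('a::finite set \<Rightarrow> real) \<Rightarrow> 'a set \<Rightarrow> real" where
  "mass Bel C = (\<Sum>T\<in>Pow C. (-1) ^ (card C + card T) * Bel T)"

text \<open>Moebius inversion: a set function is recovered from its mass.\<close>

lemma sum_mass: "(\<Sum>C\<in>Pow A. mass Bel C) = Bel A"
proof -
  define g where "g S = (\<Sum>T\<in>Pow S. (-1) ^ card T * Bel T)" for S
  have "Bel A = (\<Sum>C\<in>Pow A. (-1) ^ card C * g C)"
    by (rule inclusion_exclusion_symmetric) (auto simp: g_def)
  also have "\<dots> = (\<Sum>C\<in>Pow A. mass Bel C)"
    by (simp add: g_def mass_def sum_distrib_left power_add mult.assoc)
  finally show ?thesis ..
qed

lemma mass_nonneg:
  assumes Bel: "belief_function Bel" and "C \<noteq> {}"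
  shows "0 \<le> mass Bel C"
proof -
  obtain h where h: "bij_betw h {1..card C} C"
    using ex_bij_betw_nat_finite_1[of C] by auto
  let ?N = "card C"
  let ?A = "\<lambda>i. C - {h i}"
  have inj: "inj_on h {1..?N}" and im: "h ` {1..?N} = C"
    using h by (auto simp: bij_betw_def)
  have N: "?N \<ge> 1"
    using \<open>C \<noteq> {}\<close> by (simp add: Suc_le_eq card_gt_0_iff)
  have UN: "Bel (\<Union>i\<in>{1..?N}. ?A i) \<le> Bel C"
  proof (cases "\<exists>c. C = {c}")
    \<comment> \<open>For a singleton the union is empty instead of \<open>C\<close>.\<close>
    case True
    then have "(\<Union>i\<in>{1..?N}. ?A i) = {}"
      using im by auto
    moreover have "Bel {} \<le> Bel C"
      using Bel unfolding belief_function_def by simp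
    ultimately show ?thesis
      by (simp only:)
  next
    case False
    have "x \<in> (\<Union>i\<in>{1..?N}. ?A i)" if x: "x \<in> C" for x
    proof -
      have "C \<noteq> {x}"
        using False by simp
      then obtain y where "y \<in> C" "y \<noteq> x"
        using x by blast
      have "y \<in> h ` {1..?N}"
        using \<open>y \<in> C\<close> by (simp only: im)
      then obtain i where "i \<in> {1..?N}" "h i = y"
        by (elim imageE) simp
      then show ?thesis
        using x \<open>y \<noteq> x\<close> by blast
    qed
    then have "(\<Union>i\<in>{1..?N}. ?A i) = C"
      by blast
    then show ?thesis
      by (simp only: order_refl)
  qed
  have "0 \<le> (\<Sum>I\<in>Pow {1..?N}. (-1) ^ card I * Bel (incl_excl_set ?N ?A I))"
    unfolding inclusion_exclusion_iff[symmetric]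
    using Bel N unfolding belief_function_def by blast
  also have "\<dots> \<le> (\<Sum>I\<in>Pow {1..?N}. (-1) ^ card I * Bel (C - h ` I))"
  proof (rule sum_mono)
    fix I assume "I \<in> Pow {1..?N}"
    show "(-1) ^ card I * Bel (incl_excl_set ?N ?A I) \<le> (-1) ^ card I * Bel (C - h ` I)"
    proof (cases "I = {}")
      case True
      then show ?thesis
        using UN by (simp add: incl_excl_set_def)
    next
      case False
      then have "incl_excl_set ?N ?A I = C - h ` I"
        by (auto simp: incl_excl_set_def)
      then show ?thesis
        by simp
    qed
  qed
  also have "\<dots> = (\<Sum>D\<in>Pow C. (-1) ^ card D * Bel (C - D))"
  proof -
    have "card (h ` I) = card I" if "I \<in> Pow {1..?N}" for I
      using that inj by (auto intro: card_image inj_on_subset)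
    then have "(\<Sum>I\<in>Pow {1..?N}. (-1) ^ card I * Bel (C - h ` I)) =
        (\<Sum>I\<in>Pow {1..?N}. (-1) ^ card (h ` I) * Bel (C - h ` I))"
      by (intro sum.cong refl) (simp only:)
    then show ?thesis
      using sum.reindex_bij_betw[OF bij_betw_Pow[OF h], of "\<lambda>D. (-1) ^ card D * Bel (C - D)"]
      by (simp only:)
  qed
  also have "\<dots> = mass Bel C"
    unfolding mass_def
  proof (rule sum.reindex_bij_witness[where i = "\<lambda>T. C - T" and j = "\<lambda>T. C - T"])
    fix D assume "D \<in> Pow C"
    then have "card C = card (C - D) + card D"
      by (simp add: card_Diff_subset card_mono)
    then show "(-1) ^ (card C + card (C - D)) * Bel (C - D) = (-1) ^ card D * Bel (C - D)"
      by (simp add: power_add)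
  qed auto
  finally show ?thesis .
qed

section \<open>Guaranteed revenue\<close>

lemma belief_valuation_filter:
  assumes "C \<noteq> {}"
  shows "belief_valuation (\<lambda>A. C \<subseteq> A)"
  using assms unfolding belief_valuation_def by blast

lemma guaranteed_revenue_filter:
  assumes "C \<noteq> {}"
  shows "guaranteed_revenue (\<lambda>A. C \<subseteq> A) X = Min (X ` C)"
  unfolding guaranteed_revenue_def
proof (rule Max_eqI)
  show "y \<le> Min (X ` C)" if "y \<in> (\<lambda>A. Min (X ` A)) ` {A. C \<subseteq> A}" for y
    using that assms by (auto intro!: Min_antimono)
qed auto

lemma Min_indicator:
  fixes A :: "'a::finite set"
  assumes "C \<noteq> {}"
  shows "Min ((indicator A :: 'a \<Rightarrow> real) ` C) = (if C \<subseteq> A then 1 else 0)"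
  using assms by (intro Min_eqI) (auto simp: indicator_def)

lemma guaranteed_revenue_indicator:
  assumes "belief_valuation B"
  shows "guaranteed_revenue B (indicator A) = (if B A then 1 else 0)"
proof -
  have B: "B UNIV" "\<not> B {}" "\<And>C. B C \<Longrightarrow> C \<subseteq> A \<Longrightarrow> B A"
    using assms unfolding belief_valuation_def by (force, metis Compl_empty_eq, blast)
  have "(\<lambda>C. Min ((indicator A :: 'a \<Rightarrow> real) ` C)) ` {C. B C} =
      (\<lambda>C. if C \<subseteq> A then 1 else 0) ` {C. B C}"
    using B(2) by (intro image_cong refl Min_indicator) auto
  also have "Max \<dots> = (if B A then 1 else 0)"
  proof (rule Max_eqI)
    show "(if B A then 1 else 0) \<in> (\<lambda>C. if C \<subseteq> A then 1 else 0 :: real) ` {C. B C}"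
    proof (cases "B A")
      case True
      then show ?thesis
        by (intro image_eqI[of _ _ A]) auto
    next
      case False
      then show ?thesis
        using B by (intro image_eqI[of _ _ UNIV]) auto
    qed
  qed (use B in auto)
  finally show ?thesis
    by (simp add: guaranteed_revenue_def)
qed

section \<open>From belief functions to betting functions\<close>

text \<open>
  The mixture, with weights \<open>m\<close>, of the guaranteed revenues of all belief valuations.  For
  \<open>m = mass Bel\<close> with a belief function \<open>Bel\<close> it is the Choquet integral of \<open>X\<close> with respect to \<open>Bel\<close>.
\<close>

definition choquet :: "('a::finite set \<Rightarrow> real) \<Rightarrow> ('a \<Rightarrow> real) \<Rightarrow> real" where
  "choquet m X = (\<Sum>C | C \<noteq> {}. m C * Min (X ` C))"

lemma choquet_indicator:
  assumes "m {} = 0"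
  shows "choquet m (indicator A) = (\<Sum>C\<in>Pow A. m C)"
proof -
  have "choquet m (indicator A) = (\<Sum>C | C \<noteq> {}. if C \<subseteq> A then m C else 0)"
    unfolding choquet_def by (rule sum.cong) (auto simp: Min_indicator)
  also have "\<dots> = (\<Sum>C | C \<noteq> {} \<and> C \<subseteq> A. m C)"
    by (simp add: sum.inter_filter[symmetric])
  also have "\<dots> = (\<Sum>C\<in>Pow A. m C)"
    using assms by (intro sum.mono_neutral_left) auto
  finally show ?thesis .
qed

lemma choquet_add_const:
  assumes "(\<Sum>C | C \<noteq> {}. m C) = 1"
  shows "choquet m (\<lambda>\<omega>. X \<omega> + a) = choquet m X + a"
proof -
  have "choquet m (\<lambda>\<omega>. X \<omega> + a) = (\<Sum>C | C \<noteq> {}. m C * Min (X ` C) + m C * a)"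
    unfolding choquet_def
    by (rule sum.cong) (auto simp: Min_add_commute distrib_left)
  also have "\<dots> = choquet m X + (\<Sum>C | C \<noteq> {}. m C) * a"
    by (simp add: choquet_def sum.distrib sum_distrib_right)
  finally show ?thesis
    using assms by simp
qed

lemma choquet_scale:
  assumes "c > 0"
  shows "choquet m (\<lambda>\<omega>. c * X \<omega>) = c * choquet m X"
proof -
  have "Min ((\<lambda>\<omega>. c * X \<omega>) ` C) = c * Min (X ` C)" if "C \<noteq> {}" for C
    using that assms mono_Min_commute[of "(*) c" "X ` C"]
    by (auto simp: image_image mono_def)
  then show ?thesis
    unfolding choquet_def sum_distrib_left by (intro sum.cong) auto
qed

lemma choquet_superadditive:
  assumes "\<And>C. C \<noteq> {} \<Longrightarrow> 0 \<le> m C"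
  shows "choquet m X + choquet m Y \<le> choquet m (\<lambda>\<omega>. X \<omega> + Y \<omega>)"
proof -
  have "Min (X ` C) + Min (Y ` C) \<le> Min ((\<lambda>\<omega>. X \<omega> + Y \<omega>) ` C)" if "C \<noteq> {}" for C
    using that by (auto intro!: add_mono)
  then show ?thesis
    unfolding choquet_def sum.distrib[symmetric] distrib_left[symmetric]
    using assms by (intro sum_mono mult_left_mono) auto
qed

lemma choquet_nonneg:
  assumes "\<And>C. C \<noteq> {} \<Longrightarrow> 0 \<le> m C" and "\<And>\<omega>. 0 \<le> X \<omega>"
  shows "0 \<le> choquet m X"
  unfolding choquet_def using assms by (intro sum_nonneg mult_nonneg_nonneg) auto

lemma choquet_sum_mono:
  assumes m: "\<And>C. C \<noteq> {} \<Longrightarrow> 0 \<le> m C"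
    and le: "\<And>B. belief_valuation B \<Longrightarrow>
      (\<Sum>i\<in>I. guaranteed_revenue B (X i)) \<le> (\<Sum>j\<in>J. guaranteed_revenue B (Y j))"
  shows "(\<Sum>i\<in>I. choquet m (X i)) \<le> (\<Sum>j\<in>J. choquet m (Y j))"
proof -
  have "(\<Sum>i\<in>I. choquet m (X i)) = (\<Sum>C | C \<noteq> {}. m C * (\<Sum>i\<in>I. Min (X i ` C)))"
    unfolding choquet_def sum_distrib_left by (rule sum.swap)
  also have "\<dots> \<le> (\<Sum>C | C \<noteq> {}. m C * (\<Sum>j\<in>J. Min (Y j ` C)))"
    using m le[OF belief_valuation_filter]
    by (intro sum_mono mult_left_mono) (auto simp: guaranteed_revenue_filter)
  also have "\<dots> = (\<Sum>j\<in>J. choquet m (Y j))"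
    unfolding choquet_def sum_distrib_left by (rule sum.swap)
  finally show ?thesis .
qed

lemma belief_function_imp_betting_function:
  assumes Bel: "belief_function Bel"
  shows "\<exists>R. betting_function R \<and> coherent R \<and> B_consistent R \<and>
    (\<forall>A. Bel A = Buy R (indicator A))"
proof -
  define E where "E = choquet (mass Bel)"
  define R where "R X \<longleftrightarrow> 0 \<le> E X" for X
  note nonneg = mass_nonneg[OF Bel]
  have mass_empty: "mass Bel {} = 0"
    using Bel by (simp add: mass_def belief_function_def)
  have E_indicator: "E (indicator A) = Bel A" for A
    by (simp add: E_def choquet_indicator mass_empty sum_mass)
  have "(\<Sum>C | C \<noteq> {}. mass Bel C) = (\<Sum>C\<in>Pow UNIV. mass Bel C)"
    using mass_empty by (intro sum.mono_neutral_left) auto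
  also have "\<dots> = 1"
    using Bel unfolding sum_mass by (simp add: belief_function_def)
  finally have E_add: "E (\<lambda>\<omega>. X \<omega> + a) = E X + a" for X a
    unfolding E_def by (rule choquet_add_const)
  have Buy: "Buy R X = E X" for X
    unfolding Buy_def R_def using E_add[of X "- \<alpha>" for \<alpha>]
    by (intro Greatest_equality) auto
  have "betting_function R"
    unfolding betting_function_def R_def E_add
  proof
    fix X
    show "\<exists>\<alpha>0. (\<forall>\<alpha><\<alpha>0. \<not> 0 \<le> E X + \<alpha>) \<and> (\<forall>\<alpha>\<ge>\<alpha>0. 0 \<le> E X + \<alpha>)"
      by (intro exI[of _ "- E X"]) auto
  qed
  moreover have "coherent R"
    unfolding coherent_def R_def
  proof (intro conjI allI impI)
    show "0 \<le> E X" if "\<forall>\<omega>. 0 < X \<omega>" for X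
      unfolding E_def using nonneg that by (intro choquet_nonneg) (auto simp: less_imp_le)
    show "(0 \<le> E (\<lambda>\<omega>. c * X \<omega>)) = (0 \<le> E X)" if "0 < c" for c X
      using that by (simp add: E_def choquet_scale zero_le_mult_iff)
    show "0 \<le> E (\<lambda>\<omega>. X \<omega> + Y \<omega>)" if "0 \<le> E X \<and> 0 \<le> E Y" for X Y
      using choquet_superadditive[of "mass Bel" X Y, OF nonneg] that by (simp add: E_def)
  qed
  moreover have "B_consistent R"
    unfolding B_consistent_def Buy E_def using nonneg
    by (intro allI impI choquet_sum_mono) auto
  ultimately show ?thesis
    using Buy E_indicator by metis
qed

section \<open>From betting functions to belief functions\<close>

text \<open>
  If \<open>S\<close> is the set of the indices \<open>i\<close> for which \<open>B (A i)\<close> holds, then only the subsets of \<open>S\<close>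
  contribute to the alternating sum.  The sum is 0 if \<open>S\<close> is nonempty; otherwise only the term of
  the union can remain, and it enters with a positive sign.
\<close>

lemma valuation_inclusion_exclusion:
  assumes B: "belief_valuation B"
  shows "0 \<le> (\<Sum>I\<in>Pow {1..N}. (-1) ^ card I * (if B (incl_excl_set N A I) then 1 else 0 :: real))"
proof -
  define S where "S = {i\<in>{1..N}. B (A i)}"
  have mono: "B D" if "B C" "C \<subseteq> D" for C D
    using B that unfolding belief_valuation_def by blast
  have inter: "B (\<Inter>i\<in>I. A i)" if "finite I" "\<And>i. i \<in> I \<Longrightarrow> B (A i)" for I
    using that
  proof (induction I)
    case empty
    then show ?case
      using B by (simp add: belief_valuation_def)
  next
    case (insert i I)
    then show ?case
      using B by (simp add: belief_valuation_def)
  qed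
  have iff: "B (incl_excl_set N A I) \<longleftrightarrow> I \<subseteq> S" if "I \<subseteq> {1..N}" "I \<noteq> {}" for I
  proof
    assume "B (incl_excl_set N A I)"
    then have "B (\<Inter>i\<in>I. A i)"
      using \<open>I \<noteq> {}\<close> by (simp add: incl_excl_set_def)
    then have "B (A i)" if "i \<in> I" for i
      using that by (rule mono[OF _ INT_lower])
    then show "I \<subseteq> S"
      using \<open>I \<subseteq> {1..N}\<close> by (auto simp: S_def)
  next
    assume "I \<subseteq> S"
    then show "B (incl_excl_set N A I)"
      using inter[of I] that finite_subset[of I "{1..N}"] by (auto simp: incl_excl_set_def S_def)
  qed
  show ?thesis
  proof (cases "S = {}")
    case True
    show ?thesis
    proof (intro sum_nonneg)
      fix I assume "I \<in> Pow {1..N}"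
      then have "I = {} \<or> \<not> B (incl_excl_set N A I)"
        using iff[of I] True by auto
      then show "0 \<le> (-1) ^ card I * (if B (incl_excl_set N A I) then 1 else 0 :: real)"
        by auto
    qed
  next
    case False
    then obtain k where k: "k \<in> {1..N}" "B (A k)"
      by (auto simp: S_def)
    have "B (\<Union>i\<in>{1..N}. A i)"
      using k by (intro mono[OF k(2)] UN_upper)
    then have "B (incl_excl_set N A {})"
      by (simp add: incl_excl_set_def)
    then have "(\<Sum>I\<in>Pow {1..N}. (-1) ^ card I * (if B (incl_excl_set N A I) then 1 else 0 :: real)) =
        (\<Sum>I\<in>Pow {1..N}. if I \<subseteq> S then (-1) ^ card I else 0)"
    proof (intro sum.cong refl)
      fix I assume "I \<in> Pow {1..N}"
      then have "B (incl_excl_set N A I) \<longleftrightarrow> I \<subseteq> S"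
        using iff[of I] \<open>B (incl_excl_set N A {})\<close> by auto
      then show "(-1) ^ card I * (if B (incl_excl_set N A I) then 1 else 0 :: real) =
          (if I \<subseteq> S then (-1) ^ card I else 0)"
        by simp
    qed
    also have "\<dots> = (\<Sum>I\<in>{I\<in>Pow {1..N}. I \<subseteq> S}. (-1) ^ card I)"
      by (simp add: sum.inter_filter del: Pow_iff)
    also have "{I\<in>Pow {1..N}. I \<subseteq> S} = Pow S"
      by (auto simp: S_def)
    also have "(\<Sum>I\<in>Pow S. (-1) ^ card I) = (0 :: real)"
      using False by (subst sum_alternating_Pow) (auto simp: S_def)
    finally show ?thesis
      by simp
  qed
qed

text \<open>B-consistency for collections indexed by arbitrary finite nonempty sets.\<close>

lemma B_consistent_finite_sets:
  assumes R: "B_consistent R"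
    and I: "finite I" "I \<noteq> {}" and J: "finite J" "J \<noteq> {}"
    and le: "\<And>B. belief_valuation B \<Longrightarrow>
      (\<Sum>i\<in>I. guaranteed_revenue B (X i)) \<le> (\<Sum>j\<in>J. guaranteed_revenue B (Y j))"
  shows "(\<Sum>i\<in>I. Buy R (X i)) \<le> (\<Sum>j\<in>J. Buy R (Y j))"
proof -
  obtain g where g: "bij_betw g {1..card I} I"
    using ex_bij_betw_nat_finite_1[OF I(1)] by blast
  obtain h where h: "bij_betw h {1..card J} J"
    using ex_bij_betw_nat_finite_1[OF J(1)] by blast
  have "1 \<le> card I" "1 \<le> card J"
    using I J by (simp_all add: Suc_le_eq card_gt_0_iff)
  moreover have "(\<Sum>i=1..card I. guaranteed_revenue B (X (g i))) \<le>
      (\<Sum>j=1..card J. guaranteed_revenue B (Y (h j)))" if "belief_valuation B" for B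
    using le[OF that] sum.reindex_bij_betw[OF g, of "\<lambda>i. guaranteed_revenue B (X i)"]
      sum.reindex_bij_betw[OF h, of "\<lambda>j. guaranteed_revenue B (Y j)"] by simp
  ultimately have "(\<Sum>i=1..card I. Buy R (X (g i))) \<le> (\<Sum>j=1..card J. Buy R (Y (h j)))"
    using R[unfolded B_consistent_def, rule_format, of "card I" "card J" "X \<circ> g" "Y \<circ> h"] by simp
  then show ?thesis
    using sum.reindex_bij_betw[OF g, of "\<lambda>i. Buy R (X i)"]
      sum.reindex_bij_betw[OF h, of "\<lambda>j. Buy R (Y j)"] by simp
qed

lemma Buy_const:
  assumes bet: "betting_function R" and coh: "coherent R"
  shows "Buy R (\<lambda>_. c) = c"
proof -
  have accept: "R (\<lambda>_. a) \<longleftrightarrow> - a \<le> Buy R (\<lambda>_. 0)" for a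
    using betting_function_Buy[OF bet, of "\<lambda>_. 0" "- a"] by simp
  let ?b = "Buy R (\<lambda>_. 0)"
  have "a \<le> ?b" if "a < 0" for a
    using coh accept[of "- a"] that unfolding coherent_def by simp
  then have "0 \<le> ?b"
    by (rule dense_le)
  moreover have "?b \<le> 0"
  proof -
    \<comment> \<open>Doubling the accepted constant \<open>- ?b\<close> gives an accepted constant, so \<open>2 * ?b \<le> ?b\<close>.\<close>
    have scale: "R (\<lambda>\<omega>. k * X \<omega>) = R X" if "0 < k" for k X
      using coh that unfolding coherent_def by simp
    have "R (\<lambda>_. - ?b)"
      using accept by simp
    then have "R (\<lambda>_. 2 * - ?b)"
      using scale[of 2 "\<lambda>_. - ?b"] by simp
    then show ?thesis
      using accept by simp
  qed
  ultimately have b: "?b = 0"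
    by simp
  show ?thesis
  proof (rule antisym)
    show "Buy R (\<lambda>_. c) \<le> c"
      using betting_function_Buy[OF bet, of "\<lambda>_. c" "Buy R (\<lambda>_. c)"]
        accept[of "c - Buy R (\<lambda>_. c)"] b by simp
    show "c \<le> Buy R (\<lambda>_. c)"
      using betting_function_Buy[OF bet, of "\<lambda>_. c" c] accept[of 0] b by simp
  qed
qed

lemma Buy_inclusion_exclusion:
  assumes R: "B_consistent R" and "N \<ge> 1"
  shows "0 \<le> (\<Sum>I\<in>Pow {1..N}. (-1) ^ card I * Buy R (indicator (incl_excl_set N A I)))"
proof -
  let ?odd = "{I\<in>Pow {1..N}. odd (card I)}" and ?even = "{I\<in>Pow {1..N}. even (card I)}"
  let ?X = "\<lambda>I. indicator (incl_excl_set N A I)"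
  have "{1} \<in> ?odd" "{} \<in> ?even"
    using \<open>N \<ge> 1\<close> by auto
  then have ne: "?odd \<noteq> {}" "?even \<noteq> {}"
    by blast+
  have "(\<Sum>I\<in>?odd. Buy R (?X I)) \<le> (\<Sum>I\<in>?even. Buy R (?X I))"
  proof (rule B_consistent_finite_sets[OF R _ ne(1) _ ne(2)])
    show "(\<Sum>I\<in>?odd. guaranteed_revenue B (?X I)) \<le> (\<Sum>I\<in>?even. guaranteed_revenue B (?X I))"
      if "belief_valuation B" for B
      using valuation_inclusion_exclusion[OF that, of N A]
      by (simp add: sum_alternating_split guaranteed_revenue_indicator[OF that])
  qed auto
  then show ?thesis
    by (simp add: sum_alternating_split)
qed

lemma Buy_indicator_belief_function:
  assumes bet: "betting_function R" and coh: "coherent R" and con: "B_consistent R"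
    and Bel: "\<And>A :: 'a::finite set. Bel A = Buy R (indicator A)" and bounds: "\<And>A. Bel A \<in> {0..1}"
  shows "belief_function Bel"
  unfolding belief_function_def
proof (intro conjI allI impI)
  have "(indicator {} :: 'a \<Rightarrow> real) = (\<lambda>_. 0)" "(indicator UNIV :: 'a \<Rightarrow> real) = (\<lambda>_. 1)"
    by auto
  then show "Bel {} = 0" "Bel UNIV = 1"
    by (simp_all add: Bel Buy_const[OF bet coh])
  show "0 \<le> Bel A" "Bel A \<le> 1" for A
    using bounds[of A] by auto
  show "(\<Sum>I | I \<noteq> {} \<and> I \<subseteq> {1..N}. (-1) ^ (card I + 1) * Bel (\<Inter>i\<in>I. A i))
      \<le> Bel (\<Union>i\<in>{1..N}. A i)" if "N \<ge> 1" for N and A :: "nat \<Rightarrow> 'a set"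
    unfolding inclusion_exclusion_iff using Buy_inclusion_exclusion[OF con that] by (simp add: Bel)
qed

section \<open>The equivalence\<close>

theorem theorem3p10:
  fixes Bel :: "'a::finite set \<Rightarrow> real"
  assumes "\<And>A. Bel A \<in> {0..1}"
  shows "belief_function Bel \<longleftrightarrow>
    (\<exists>R :: ('a \<Rightarrow> real) \<Rightarrow> bool.
       betting_function R \<and> coherent R \<and> B_consistent R \<and>
       (\<forall>A. Bel A = Buy R (indicator A)))"
  using belief_function_imp_betting_function[of Bel] Buy_indicator_belief_function[of _ Bel] assms
  by blast

end
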